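(* Let $\{r_n\}_{n=1}^\infty$ be a sequence of reals with $r_n > \frac{1}{2}$ for every $n$, and let $p(n)$ be the smallest prime strictly greater than $\frac{m(n)}{8r_n^2}$. Suppose there is a constant $\kappa < 2$ such that for all sufficiently large $n$, $$\frac{m(n)}{4} < p(n) < \frac{m(n)}{2} - \sqrt{\frac{m(n)\ln m(n)}{\kappa}}.$$ Then there exists $n_0$ such that $\chi(S_{r_n}^{n-1}) > n+1$ for all $n \ge n_0$.
   Context: $S_r^{n-1} = \{x \in \mathbb{R}^n : \|x\|_2 = r\}$ is the Euclidean sphere of radius $r$ in $\mathbb{R}^n$; $\chi(S_r^{n-1})$ is the minimum number of colours needed to colour its points so that any two points at Euclidean distance exactly $1$ receive different colours. For real $x$, $m(x) = \max\{m < x : m \equiv 0 \pmod 4\}$ (the largest nonnegative integer multiple of $4$ strictly less than $x$). *)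

theory Defs
  imports "HOL-Analysis.Analysis" "HOL-Computational_Algebra.Primes" "HOL-Library.Extended_Nat"
begin

text \<open>
  The dimension \<open>n\<close> varies inside the statements, so it cannot be a type.  Points of
  \<open>\<real>\<^sup>n\<close> are the functions \<open>nat \<Rightarrow> real\<close> that vanish outside \<open>{..<n}\<close>, i.e. the elements of
  \<open>topspace (Euclidean_space n)\<close>.  The type \<open>nat \<Rightarrow> real\<close> also carries a library metric \<open>dist\<close> for the
  product topology; it is not the Euclidean one and is not used.
\<close>

definition eucl_dist :: "nat \<Rightarrow> (nat \<Rightarrow> real) \<Rightarrow> (nat \<Rightarrow> real) \<Rightarrow> real" where
  "eucl_dist n x y = L2_set (\<lambda>i. x i - y i) {..<n}"

text \<open>\<open>eucl_sphere n r\<close> is the sphere of radius \<open>r\<close> in \<open>\<real>\<^sup>n\<close>, of dimension \<open>n - 1\<close>.\<close>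

definition eucl_sphere :: "nat \<Rightarrow> real \<Rightarrow> (nat \<Rightarrow> real) set" where
  "eucl_sphere n r = {x \<in> topspace (Euclidean_space n). L2_set x {..<n} = r}"

definition unit_dist_colouring ::
  "nat \<Rightarrow> (nat \<Rightarrow> real) set \<Rightarrow> nat \<Rightarrow> ((nat \<Rightarrow> real) \<Rightarrow> nat) \<Rightarrow> bool" where
  "unit_dist_colouring n S k c \<longleftrightarrow>
     c ` S \<subseteq> {..<k} \<and> (\<forall>x\<in>S. \<forall>y\<in>S. eucl_dist n x y = 1 \<longrightarrow> c x \<noteq> c y)"

text \<open>The value is \<open>\<infinity>\<close> if no finite number of colours suffices.\<close>

definition chromatic_number :: "nat \<Rightarrow> (nat \<Rightarrow> real) set \<Rightarrow> enat" where
  "chromatic_number n S = Inf {enat k | k. \<exists>c. unit_dist_colouring n S k c}"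

text \<open>Only meaningful for \<open>x > 0\<close>; otherwise the set is empty.\<close>

definition mult4_below :: "real \<Rightarrow> nat" where
  "mult4_below x = Max {k. 4 dvd k \<and> real k < x}"

definition least_prime_above :: "real \<Rightarrow> nat" where
  "least_prime_above x = (LEAST p. prime p \<and> x < real p)"

end

theory Submission
  imports Defs "HOL-Real_Asymp.Real_Asymp"
begin

text \<open>Frankl--Wilson argument. The sign vectors \<open>{\<plusminus>1}\<^sup>m\<close>, scaled by \<open>1 / sqrt (8p)\<close>, lie on a sphere of
  squared radius \<open>m / (8p) < r\<^sup>2\<close>, so the spare dimension \<open>n > m\<close> allows placing them on the sphere of
  radius \<open>r\<close>. Two of them are at distance 1 iff they differ in exactly \<open>2p\<close> places. A colour class of
  fixed parity therefore has no Hamming distance divisible by \<open>p\<close>, and the polynomial method modulo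
  \<open>p\<close> bounds its size by the sum of the first \<open>p\<close> binomial coefficients, which by Chernoff's bound is at
  most \<open>2\<^sup>m m powr (- 2 / \<kappa>)\<close>. As \<open>2 / \<kappa> > 1\<close>, more than \<open>n + 1\<close> colours are needed.\<close>

section \<open>Rank arguments over the integers\<close>

text \<open>Gaussian elimination on the columns in \<open>S\<close>, one at a time. Rows are
  multiplied by the pivot rather than divided by it, so the argument stays inside an integral domain
  and applies to \<open>int\<close>.\<close>

lemma nontrivial_linear_relation:
  fixes u :: "'x \<Rightarrow> 's \<Rightarrow> 'c::idom"
  assumes "finite S" "finite X" "card S < card X"
  shows "\<exists>c. (\<exists>x\<in>X. c x \<noteq> 0) \<and> (\<forall>s\<in>S. (\<Sum>x\<in>X. c x * u x s) = 0)"
  using assms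
proof (induction S arbitrary: X u rule: finite_induct)
  case empty
  then have "X \<noteq> {}" by auto
  then show ?case by (intro exI[of _ "\<lambda>_. 1"]) auto
next
  case (insert s0 S X u)
  show ?case
  proof (cases "\<forall>x\<in>X. u x s0 = 0")
    case True
    have "card S < card X" using insert by simp
    from insert.IH[OF insert.prems(1) this, of u] obtain c
      where "\<exists>x\<in>X. c x \<noteq> 0" "\<forall>s\<in>S. (\<Sum>x\<in>X. c x * u x s) = 0" by blast
    then show ?thesis using True by (intro exI[of _ c]) auto
  next
    case False
    then obtain x0 where x0: "x0 \<in> X" "u x0 s0 \<noteq> 0" by blast
    define a where "a = u x0 s0"
    define Y where "Y = X - {x0}"
    have Y: "finite Y" "x0 \<notin> Y" "X = insert x0 Y" using x0 insert.prems by (auto simp: Y_def)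
    then have "card S < card Y" using insert by simp
    from insert.IH[OF Y(1) this, of "\<lambda>x s. a * u x s - u x s0 * u x0 s"] obtain c
      where c: "\<exists>x\<in>Y. c x \<noteq> 0"
        "\<And>s. s \<in> S \<Longrightarrow> (\<Sum>x\<in>Y. c x * (a * u x s - u x s0 * u x0 s)) = 0" by blast
    \<comment> \<open>The coefficient of the pivot row is the one that cancels column
      \<open>s0\<close>; scaling the other coefficients by the pivot \<open>a\<close> avoids the
      division.\<close>
    define d where "d x = (if x = x0 then - (\<Sum>x\<in>Y. c x * u x s0) else a * c x)" for x
    have sum_d: "(\<Sum>x\<in>X. d x * u x s) = (\<Sum>x\<in>Y. c x * (a * u x s - u x s0 * u x0 s))" for s
    proof -
      have "(\<Sum>x\<in>Y. d x * u x s) = (\<Sum>x\<in>Y. a * c x * u x s)"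
        using Y by (intro sum.cong) (auto simp: d_def)
      then show ?thesis
        using Y by (simp add: d_def[of x0] sum_subtractf algebra_simps sum_distrib_left)
    qed
    have "(\<Sum>x\<in>X. d x * u x s) = 0" if "s \<in> insert s0 S" for s
      using that c(2)[of s] unfolding sum_d by (auto simp: a_def algebra_simps)
    moreover have "\<exists>x\<in>X. d x \<noteq> 0"
      using c(1) Y x0 by (auto simp: d_def a_def)
    ultimately show ?thesis by blast
  qed
qed

text \<open>A matrix that is diagonal and nonsingular modulo \<open>p\<close> has full rank over the integers: a
  relation between its rows has all coefficients divisible by \<open>p\<close>, and dividing by \<open>p\<close> gives
  another relation, so the coefficients are divisible by every power of \<open>p\<close>.\<close>

lemma card_le_of_diagonal_mod_prime:
  fixes u :: "'x \<Rightarrow> 's \<Rightarrow> int" and v :: "'s \<Rightarrow> 'x \<Rightarrow> int" and p :: int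
  assumes p: "prime p" and fin: "finite S" "finite X"
    and diag: "\<And>x. x \<in> X \<Longrightarrow> \<not> p dvd (\<Sum>s\<in>S. u x s * v s x)"
    and off: "\<And>x y. x \<in> X \<Longrightarrow> y \<in> X \<Longrightarrow> x \<noteq> y \<Longrightarrow> p dvd (\<Sum>s\<in>S. u x s * v s y)"
  shows "card X \<le> card S"
proof (rule ccontr)
  assume "\<not> ?thesis"
  then obtain c where c: "\<exists>x\<in>X. c x \<noteq> 0" "\<forall>s\<in>S. (\<Sum>x\<in>X. c x * u x s) = 0"
    using nontrivial_linear_relation[OF fin, of u] by auto
  have rel: "(\<Sum>x\<in>X. c x * (\<Sum>s\<in>S. u x s * v s y)) = 0" for y
  proof -
    have "(\<Sum>x\<in>X. c x * (\<Sum>s\<in>S. u x s * v s y)) = (\<Sum>s\<in>S. (\<Sum>x\<in>X. c x * u x s) * v s y)"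
      by (simp add: sum_distrib_left sum_distrib_right sum.swap[of _ X] mult.assoc)
    then show ?thesis using c(2) by simp
  qed
  have pow: "\<forall>y\<in>X. p ^ k dvd c y" for k
  proof (induction k)
    case (Suc k)
    then obtain d where d: "\<And>y. y \<in> X \<Longrightarrow> c y = p ^ k * d y" unfolding dvd_def by metis
    have "p dvd d y" if y: "y \<in> X" for y
    proof -
      have "p ^ k * (\<Sum>x\<in>X. d x * (\<Sum>s\<in>S. u x s * v s y)) = 0"
        using rel[of y] d by (simp add: sum_distrib_left mult.assoc cong: sum.cong)
      then have "(\<Sum>x\<in>X. d x * (\<Sum>s\<in>S. u x s * v s y)) = 0" using p by auto
      then have "d y * (\<Sum>s\<in>S. u y s * v s y) = - (\<Sum>x\<in>X - {y}. d x * (\<Sum>s\<in>S. u x s * v s y))"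
        using sum.remove[OF fin(2) y, of "\<lambda>x. d x * (\<Sum>s\<in>S. u x s * v s y)"] by simp
      moreover have "p dvd (\<Sum>x\<in>X - {y}. d x * (\<Sum>s\<in>S. u x s * v s y))"
        by (rule dvd_sum) (use off y in simp)
      ultimately have "p dvd d y * (\<Sum>s\<in>S. u y s * v s y)" by (simp only: dvd_minus_iff)
      then show ?thesis using p diag[OF y] prime_dvd_mult_iff by blast
    qed
    then show ?case using d by simp
  qed simp
  obtain y where y: "y \<in> X" "c y \<noteq> 0" using c(1) by blast
  have "p \<noteq> 0" "\<not> is_unit p" using p by auto
  then have "finite {k. p ^ k dvd c y}"
    using y finite_divisor_powers by blast
  moreover have "{k. p ^ k dvd c y} = UNIV" using pow y(1) by auto
  ultimately show False by simp
qed

section \<open>Multilinear polynomials on the Boolean cube\<close>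

text \<open>These are the integer multilinear polynomials of degree at most \<open>k\<close> in the
  0/1 indicator variables of \<open>B\<close>: \<open>of_bool (S \<subseteq> B)\<close> is the
  monomial that multiplies the variables of \<open>S\<close>.\<close>

definition subset_poly :: "'a set \<Rightarrow> nat \<Rightarrow> ('a set \<Rightarrow> int) \<Rightarrow> bool" where
  "subset_poly U k g \<longleftrightarrow>
     (\<exists>u. \<forall>B\<subseteq>U. g B = (\<Sum>S | S \<subseteq> U \<and> card S \<le> k. u S * of_bool (S \<subseteq> B)))"

lemma subset_poly_monomial:
  assumes "finite U" "T \<subseteq> U" "card T \<le> k"
  shows "subset_poly U k (\<lambda>B. a * of_bool (T \<subseteq> B))"
  unfolding subset_poly_def
proof (intro exI allI impI)
  fix B
  let ?I = "{S. S \<subseteq> U \<and> card S \<le> k}"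
  have "(\<Sum>S\<in>?I. (if S = T then a else 0) * of_bool (S \<subseteq> B)) =
        (\<Sum>S\<in>?I. if S = T then a * of_bool (T \<subseteq> B) else 0)"
    by (intro sum.cong) auto
  then show "a * of_bool (T \<subseteq> B) = (\<Sum>S\<in>?I. (if S = T then a else 0) * of_bool (S \<subseteq> B))"
    using assms by (simp add: sum.delta)
qed

lemma subset_poly_add:
  assumes "subset_poly U k f" "subset_poly U k g"
  shows "subset_poly U k (\<lambda>B. f B + g B)"
proof -
  from assms obtain u v
    where "\<forall>B\<subseteq>U. f B = (\<Sum>S | S \<subseteq> U \<and> card S \<le> k. u S * of_bool (S \<subseteq> B))"
      and "\<forall>B\<subseteq>U. g B = (\<Sum>S | S \<subseteq> U \<and> card S \<le> k. v S * of_bool (S \<subseteq> B))"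
    unfolding subset_poly_def by blast
  then show ?thesis
    unfolding subset_poly_def
    by (intro exI[of _ "\<lambda>S. u S + v S"]) (simp add: sum.distrib distrib_right)
qed

lemma subset_poly_sum:
  assumes "finite U" "\<And>i. i \<in> I \<Longrightarrow> subset_poly U k (f i)"
  shows "subset_poly U k (\<lambda>B. \<Sum>i\<in>I. f i B)"
proof -
  have zero: "subset_poly U k (\<lambda>B. 0)"
    using subset_poly_monomial[OF assms(1), of "{}" k 0] by simp
  show ?thesis
    using assms(2)
    by (induction I rule: infinite_finite_induct) (simp_all add: zero subset_poly_add)
qed

lemma subset_poly_cong:
  assumes "subset_poly U k f" "\<And>B. B \<subseteq> U \<Longrightarrow> f B = g B"
  shows "subset_poly U k g"
  using assms unfolding subset_poly_def by simp

text \<open>Multiplying the monomial of \<open>S\<close> by the variable of \<open>i\<close> gives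
  the monomial of \<open>insert i S\<close>. Indicators are idempotent, so the result is again
  multilinear and the degree grows by at most one.\<close>

lemma subset_poly_mult_affine:
  assumes fin: "finite U" and f: "subset_poly U k f"
  shows "subset_poly U (Suc k) (\<lambda>B. f B * (a + (\<Sum>i\<in>U. e i * of_bool (i \<in> B))))"
proof -
  obtain u where u: "\<And>B. B \<subseteq> U \<Longrightarrow> f B = (\<Sum>S | S \<subseteq> U \<and> card S \<le> k. u S * of_bool (S \<subseteq> B))"
    using f unfolding subset_poly_def by blast
  let ?I = "{S. S \<subseteq> U \<and> card S \<le> k}"
  have "subset_poly U (Suc k) (\<lambda>B. \<Sum>S\<in>?I. a * u S * of_bool (S \<subseteq> B)
          + (\<Sum>i\<in>U. e i * u S * of_bool (insert i S \<subseteq> B)))"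
    using fin by (intro subset_poly_sum subset_poly_add subset_poly_monomial)
      (auto simp: card_insert_if dest: finite_subset)
  then show ?thesis
  proof (rule subset_poly_cong)
    fix B assume "B \<subseteq> U"
    have "(\<Sum>S\<in>?I. u S * of_bool (S \<subseteq> B)) * (a + (\<Sum>i\<in>U. e i * of_bool (i \<in> B))) =
      (\<Sum>S\<in>?I. a * u S * of_bool (S \<subseteq> B) + (\<Sum>i\<in>U. e i * u S * of_bool (insert i S \<subseteq> B)))"
      unfolding sum_distrib_right
      by (intro sum.cong refl)
         (simp add: distrib_left sum_distrib_left of_bool_conj mult_ac)
    then show "(\<Sum>S\<in>?I. a * u S * of_bool (S \<subseteq> B) + (\<Sum>i\<in>U. e i * u S * of_bool (insert i S \<subseteq> B)))
       = f B * (a + (\<Sum>i\<in>U. e i * of_bool (i \<in> B)))"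
      using u[OF \<open>B \<subseteq> U\<close>] by simp
  qed
qed

lemma subset_poly_prod_affine:
  assumes "finite U" "finite J"
  shows "subset_poly U (card J) (\<lambda>B. \<Prod>j\<in>J. a j + (\<Sum>i\<in>U. e j i * of_bool (i \<in> B)))"
  using assms(2)
proof (induction J rule: finite_induct)
  case empty
  then show ?case using subset_poly_monomial[OF assms(1), of "{}" 0 1] by simp
next
  case (insert j J)
  then show ?case
    using subset_poly_mult_affine[OF assms(1) insert.IH, of "a j" "e j"]
    by (simp add: mult.commute)
qed

section \<open>Set families with restricted Hamming distances\<close>

text \<open>Starting from \<open>B = {}\<close>, each element put into \<open>B\<close> lowers the
  distance to \<open>A\<close> by one if it lies in \<open>A\<close> and raises it by one
  otherwise.\<close>

lemma card_sym_diff_affine: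
  assumes "finite U" "A \<subseteq> U" "B \<subseteq> U"
  shows "int (card (sym_diff A B)) =
    int (card A) + (\<Sum>i\<in>U. (if i \<in> A then -1 else 1) * of_bool (i \<in> B))"
proof -
  have U: "card C = (\<Sum>i\<in>U. of_bool (i \<in> C))" if "C \<subseteq> U" for C
    using that assms(1) by (simp add: sum.If_cases of_bool_def Int_absorb1)
  have "sym_diff A B \<subseteq> U" using assms by auto
  then show ?thesis
    by (auto simp: U assms(2) simp flip: sum.distrib intro!: sum.cong)
qed

lemma even_card_sym_diff:
  assumes "finite A" "finite B"
  shows "even (card (sym_diff A B)) \<longleftrightarrow> (even (card A) \<longleftrightarrow> even (card B))"
proof -
  have "card (sym_diff A B) = card (A - B) + card (B - A)"
    using assms by (intro card_Un_disjoint) auto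
  moreover have "card A = card (A - B) + card (A \<inter> B)" "card B = card (B - A) + card (A \<inter> B)"
    using assms by (metis card_Diff_subset_Int card_mono Int_lower1 le_add_diff_inverse2 finite_Int
      Int_commute)+
  ultimately show ?thesis by auto
qed

lemma card_subsets_card_le:
  assumes "finite U"
  shows "card {S. S \<subseteq> U \<and> card S \<le> k} = (\<Sum>i\<le>k. card U choose i)"
proof -
  have "{S. S \<subseteq> U \<and> card S \<le> k} = (\<Union>i\<le>k. {S. S \<subseteq> U \<and> card S = i})" by auto
  also have "card \<dots> = (\<Sum>i\<le>k. card {S. S \<subseteq> U \<and> card S = i})"
    using assms by (intro card_UN_disjoint) auto
  finally show ?thesis using assms by (simp add: n_subsets)
qed

text \<open>The product \<open>M A B\<close> of the factors \<open>d - j\<close> for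
  \<open>0 < j < p\<close>, with \<open>d\<close> the Hamming distance, vanishes modulo
  \<open>p\<close> unless \<open>p\<close> divides \<open>d\<close>. For fixed \<open>A\<close> it
  has degree at most \<open>p - 1\<close> in \<open>B\<close>, so the matrix \<open>M\<close>
  factors through the monomials of that degree, and their number bounds its rank.\<close>

lemma card_family_sym_diff_mod_prime:
  fixes p :: nat
  assumes p: "prime p" and fin: "finite U" and F: "\<And>A. A \<in> F \<Longrightarrow> A \<subseteq> U"
    and mod: "\<And>A B. A \<in> F \<Longrightarrow> B \<in> F \<Longrightarrow> A \<noteq> B \<Longrightarrow> \<not> p dvd card (sym_diff A B)"
  shows "card F \<le> (\<Sum>k<p. card U choose k)"
proof -
  define M where "M A B = (\<Prod>j\<in>{1..<p}. int (card (sym_diff A B)) - int j)" for A B :: "'a set"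
  have "\<forall>A\<in>F. \<exists>u. \<forall>B\<subseteq>U.
      M A B = (\<Sum>S | S \<subseteq> U \<and> card S \<le> p - 1. u S * of_bool (S \<subseteq> B))"
  proof
    fix A assume "A \<in> F"
    have "subset_poly U (card {1..<p}) (\<lambda>B. \<Prod>j\<in>{1..<p}. (int (card A) - int j)
            + (\<Sum>i\<in>U. (if i \<in> A then -1 else 1) * of_bool (i \<in> B)))"
      by (rule subset_poly_prod_affine[OF fin finite_atLeastLessThan])
    then have "subset_poly U (card {1..<p}) (M A)"
      by (rule subset_poly_cong)
         (simp add: M_def card_sym_diff_affine[OF fin F[OF \<open>A \<in> F\<close>]] algebra_simps)
    then show "\<exists>u. \<forall>B\<subseteq>U.
        M A B = (\<Sum>S | S \<subseteq> U \<and> card S \<le> p - 1. u S * of_bool (S \<subseteq> B))"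
      unfolding subset_poly_def by simp
  qed
  from bchoice[OF this] obtain u where u: "\<And>A B. A \<in> F \<Longrightarrow> B \<subseteq> U \<Longrightarrow>
      M A B = (\<Sum>S | S \<subseteq> U \<and> card S \<le> p - 1. u A S * of_bool (S \<subseteq> B))"
    by blast
  have "card F \<le> card {S. S \<subseteq> U \<and> card S \<le> p - 1}"
  proof (rule card_le_of_diagonal_mod_prime[of "int p" _ _ u "\<lambda>S B. of_bool (S \<subseteq> B)"])
    show "finite F" using F fin by (meson PowI finite_Pow_iff finite_subset subsetI)
    fix A assume A: "A \<in> F"
    \<comment> \<open>On the diagonal the distance is 0, so the factors are \<open>-j\<close> with
      \<open>0 < j < p\<close>, none divisible by \<open>p\<close>.\<close>
    have "\<not> int p dvd M A A"
      using p by (auto simp: M_def prime_dvd_prod_iff dest: zdvd_imp_le)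
    then show "\<not> int p dvd (\<Sum>S | S \<subseteq> U \<and> card S \<le> p - 1. u A S * of_bool (S \<subseteq> A))"
      using u[OF A F[OF A]] by simp
  next
    fix A B assume AB: "A \<in> F" "B \<in> F" "A \<noteq> B"
    define d where "d = card (sym_diff A B)"
    have "\<not> p dvd d" using mod AB by (simp add: d_def)
    \<comment> \<open>The residue of \<open>d\<close> is one of the indices \<open>j\<close>, and
      the factor at that index is divisible by \<open>p\<close>.\<close>
    then have "d mod p \<in> {1..<p}" using p by (auto simp: prime_gt_0_nat Suc_le_eq dvd_eq_mod_eq_0)
    moreover have "int p dvd int d - int (d mod p)" by (simp add: of_nat_mod)
    ultimately have "int p dvd M A B"
      unfolding M_def d_def[symmetric] by (meson dvd_prodI dvd_trans finite_atLeastLessThan)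
    then show "int p dvd (\<Sum>S | S \<subseteq> U \<and> card S \<le> p - 1. u A S * of_bool (S \<subseteq> B))"
      using u[OF AB(1) F[OF AB(2)]] by simp
  qed (use p fin in auto)
  also have "\<dots> = (\<Sum>k\<le>p - 1. card U choose k)" using fin by (rule card_subsets_card_le)
  also have "{..p - 1} = {..<p}" using p prime_gt_0_nat[of p] by auto
  finally show ?thesis .
qed

section \<open>Chernoff bound for binomial sums\<close>

text \<open>The power series compare term by term, because
  \<open>2 ^ n * fact n <= fact (2 * n)\<close>.\<close>

lemma cosh_le_exp_half_square: "cosh (x::real) \<le> exp (x\<^sup>2 / 2)"
proof (rule sums_le)
  have scaleR_eq_divide: "a /\<^sub>R b = a / b" for a b :: real by (simp add: divide_inverse)
  show "(\<lambda>n. x ^ (2 * n) /\<^sub>R fact (2 * n)) sums cosh x"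
    using cosh_converges[of x] sums_mono_reindex[of "\<lambda>n. 2 * n"
      "\<lambda>n. if even n then x ^ n /\<^sub>R fact n else 0" "cosh x"]
    by (simp add: strict_mono_def) (metis (mono_tags, lifting) evenE rangeI)
  show "(\<lambda>n. (x\<^sup>2 / 2) ^ n /\<^sub>R fact n) sums exp (x\<^sup>2 / 2)" by (rule exp_converges)
  fix n
  have "2 ^ n * fact n \<le> (fact (2 * n) :: real)"
  proof (induction n)
    case (Suc n)
    have "2 ^ Suc n * fact (Suc n) = (2 * real (Suc n)) * (2 ^ n * fact n :: real)"
      by (simp add: algebra_simps)
    also have "\<dots> \<le> (2 * real (Suc n)) * (real (2 * n + 1) * fact (2 * n))"
      using Suc.IH by (intro mult_left_mono order_trans[OF Suc.IH]) auto
    also have "\<dots> = fact (2 * Suc n)" by (simp add: algebra_simps)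
    finally show ?case .
  qed simp
  then have "x ^ (2 * n) / fact (2 * n) \<le> x ^ (2 * n) / (2 ^ n * fact n)"
    by (intro divide_left_mono) auto
  then show "x ^ (2 * n) /\<^sub>R fact (2 * n) \<le> (x\<^sup>2 / 2) ^ n /\<^sub>R fact n"
    by (simp only: scaleR_eq_divide power_divide power_mult divide_divide_eq_left)
qed

text \<open>Each term with \<open>k < p\<close> is given an exponential weight of at least 1. The
  weighted sum, extended to all \<open>k <= m\<close>, is evaluated by the binomial theorem as a
  power of a hyperbolic cosine.\<close>

lemma binomial_lower_tail:
  fixes t :: real
  assumes m: "m > 0" and t: "0 \<le> t" and p: "real p \<le> real m / 2 - t"
  shows "real (\<Sum>k<p. m choose k) \<le> 2 ^ m * exp (- 2 * t\<^sup>2 / real m)"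
proof -
  \<comment> \<open>This value minimises the final exponent
    \<open>- l * t + m * l^2 / 8\<close>.\<close>
  define l where "l = 4 * t / real m"
  have l: "l \<ge> 0" using t by (simp add: l_def)
  have pm: "p \<le> m" using p t by simp
  have "real (\<Sum>k<p. m choose k) \<le> (\<Sum>k<p. real (m choose k) * exp (l * (m / 2 - t - k)))"
    unfolding of_nat_sum
  proof (rule sum_mono)
    fix k assume "k \<in> {..<p}"
    then have "0 \<le> l * (m / 2 - t - k)" using l p by (intro mult_nonneg_nonneg) auto
    then have "1 \<le> exp (l * (m / 2 - t - k))" by simp
    then show "real (m choose k) \<le> real (m choose k) * exp (l * (m / 2 - t - k))"
      using mult_left_mono[of 1 _ "real (m choose k)"] by simp
  qed
  also have "\<dots> \<le> (\<Sum>k\<le>m. real (m choose k) * exp (l * (m / 2 - t - k)))"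
    using pm by (intro sum_mono2) auto
  also have "\<dots> = exp (- l * t) * (\<Sum>k\<le>m. real (m choose k) * exp (- l / 2) ^ k * exp (l / 2) ^ (m - k))"
    unfolding sum_distrib_left
  proof (intro sum.cong refl)
    fix k assume k: "k \<in> {..m}"
    have "l * (m / 2 - t - k) = - l * t + (real k * (- l / 2) + real (m - k) * (l / 2))"
      using k by (simp add: of_nat_diff field_simps)
    then have "exp (l * (m / 2 - t - k)) = exp (- l * t) * (exp (- l / 2) ^ k * exp (l / 2) ^ (m - k))"
      by (simp only: exp_add exp_of_nat_mult)
    then show "real (m choose k) * exp (l * (m / 2 - t - k)) =
      exp (- l * t) * (real (m choose k) * exp (- l / 2) ^ k * exp (l / 2) ^ (m - k))"
      by simp
  qed
  also have "\<dots> = exp (- l * t) * (exp (- l / 2) + exp (l / 2)) ^ m"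
    by (simp add: binomial_ring)
  also have "\<dots> = exp (- l * t) * (2 * cosh (l / 2)) ^ m"
    by (simp add: cosh_field_def add_divide_distrib add.commute)
  also have "\<dots> \<le> exp (- l * t) * (2 * exp ((l / 2)\<^sup>2 / 2)) ^ m"
    using cosh_le_exp_half_square by (intro mult_left_mono power_mono) auto
  also have "\<dots> = 2 ^ m * exp (- l * t + m * ((l / 2)\<^sup>2 / 2))"
    by (simp only: power_mult_distrib exp_add exp_of_nat_mult mult.left_commute)
  also have "- l * t + m * ((l / 2)\<^sup>2 / 2) = - 2 * t\<^sup>2 / m"
    using m by (simp add: l_def field_simps power2_eq_square)
  finally show ?thesis .
qed

section \<open>Sign vectors on the sphere and their colour classes\<close>

lemma sum_sign_diff_squares:
  assumes "finite U" "A \<subseteq> U" "B \<subseteq> U"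
  shows "(\<Sum>i\<in>U. ((if i \<in> A then - h else h) - (if i \<in> B then - h else h :: real))\<^sup>2) =
    4 * h\<^sup>2 * card (sym_diff A B)"
proof -
  have "(\<Sum>i\<in>U. ((if i \<in> A then - h else h) - (if i \<in> B then - h else h))\<^sup>2) =
      (\<Sum>i\<in>U. if i \<in> sym_diff A B then 4 * h\<^sup>2 else 0)"
    by (intro sum.cong) (auto simp: power2_eq_square)
  also have "\<dots> = (\<Sum>i\<in>sym_diff A B. 4 * h\<^sup>2)"
    using assms by (intro sum.mono_neutral_cong_right) auto
  finally show ?thesis by simp
qed

text \<open>Patterns of equal parity differ in an even number of places, and the only nonzero multiple of \<open>p\<close>
  that is even and at most \<open>m < 4p\<close> is \<open>2p\<close>.\<close>

lemma sphere_colouring_bound: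
  assumes p: "prime p" "odd p" and mp: "m < 4 * p" and mn: "m < n"
    and r: "0 \<le> r" "real m / (8 * real p) \<le> r\<^sup>2"
    and col: "unit_dist_colouring n (eucl_sphere n r) k c"
  shows "2 ^ m \<le> 2 * k * (\<Sum>j<p. m choose j)"
proof -
  \<comment> \<open>The scale makes \<open>2 * p\<close> differing signs contribute
    \<open>4 * h^2 * 2 * p = 1\<close> to the squared distance.\<close>
  define h where "h = 1 / sqrt (8 * real p)"
  \<comment> \<open>This common value of coordinate \<open>m\<close> lifts the squared norm from
    \<open>m * h^2\<close> to \<open>r^2\<close> and cancels in all differences.\<close>
  define z where "z = sqrt (r\<^sup>2 - real m / (8 * real p))"
  define f where "f A i = (if i < m then if i \<in> A then - h else h else if i = m then z else 0)"
    for A :: "nat set" and i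
  have p0: "p > 0" using p prime_gt_0_nat by blast
  have h2: "h\<^sup>2 = 1 / (8 * real p)" by (simp add: h_def power_divide)
  have split: "{..<n} = {..<m} \<union> {m} \<union> {m<..<n}" using mn by auto
  have sum_n: "sum g {..<n} = sum g {..<m} + g m" if "\<And>i. i > m \<Longrightarrow> g i = 0" for g :: "nat \<Rightarrow> real"
    unfolding split using that by (subst sum.union_disjoint | force)+
  have sphere: "f A \<in> eucl_sphere n r" for A
  proof -
    have "(\<Sum>i<n. (f A i)\<^sup>2) = (\<Sum>i<m. (f A i)\<^sup>2) + (f A m)\<^sup>2" by (rule sum_n) (simp add: f_def)
    also have "(\<Sum>i<m. (f A i)\<^sup>2) = (\<Sum>i<m. h\<^sup>2)" by (intro sum.cong) (auto simp: f_def)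
    also have "\<dots> + (f A m)\<^sup>2 = r\<^sup>2" using r(2) by (simp add: f_def z_def h2)
    finally show ?thesis
      using r(1) mn by (simp add: eucl_sphere_def topspace_Euclidean_space L2_set_def f_def)
  qed
  have dist: "eucl_dist n (f A) (f B) = 1"
    if "A \<subseteq> {..<m}" "B \<subseteq> {..<m}" "card (sym_diff A B) = 2 * p" for A B
  proof -
    have "(\<Sum>i<n. (f A i - f B i)\<^sup>2) = (\<Sum>i<m. (f A i - f B i)\<^sup>2) + (f A m - f B m)\<^sup>2"
      by (rule sum_n) (simp add: f_def)
    also have "\<dots> = (\<Sum>i<m. ((if i \<in> A then - h else h) - (if i \<in> B then - h else h))\<^sup>2)"
      by (simp add: f_def)
    also have "\<dots> = 1"
      using p0 that by (subst sum_sign_diff_squares) (simp_all add: h2)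
    finally show ?thesis by (simp add: eucl_dist_def L2_set_def)
  qed
  \<comment> \<open>Splitting each colour class by parity costs the factor 2 in the conclusion and
    makes all distances within a class even.\<close>
  define cls where "cls b j = {A. A \<subseteq> {..<m} \<and> even (card A) = b \<and> c (f A) = j}" for b j
  have "card (cls b j) \<le> (\<Sum>j<p. card {..<m} choose j)" for b j
  proof (rule card_family_sym_diff_mod_prime[OF p(1)])
    fix A B assume A: "A \<in> cls b j" and B: "B \<in> cls b j" and "A \<noteq> B"
    have sub: "A \<subseteq> {..<m}" "B \<subseteq> {..<m}" using A B by (auto simp: cls_def)
    then have fin: "finite A" "finite B" using finite_subset by blast+
    define d where "d = card (sym_diff A B)"
    have "even d"
      using A B even_card_sym_diff[OF fin] by (auto simp: d_def cls_def)
    have "card (sym_diff A B) \<le> card {..<m}"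
      using sub by (intro card_mono) auto
    then have "d \<le> m" by (simp add: d_def)
    have "d \<noteq> 0" using \<open>A \<noteq> B\<close> fin by (auto simp: d_def)
    have "d \<noteq> 2 * p"
    proof
      assume "d = 2 * p"
      then have "eucl_dist n (f A) (f B) = 1" using dist[OF sub] by (simp add: d_def)
      then have "c (f A) \<noteq> c (f B)" using col sphere unfolding unit_dist_colouring_def by blast
      then show False using A B by (simp add: cls_def)
    qed
    show "\<not> p dvd card (sym_diff A B)" unfolding d_def[symmetric]
    proof
      assume "p dvd d"
      then have "2 * p dvd d"
        using \<open>even d\<close> p(2) by (intro divides_mult) auto
      then obtain q where q: "d = 2 * p * q" by (elim dvdE)
      have "q < 2"
      proof (rule ccontr)
        assume "\<not> q < 2"
        then have "2 * p * 2 \<le> d" unfolding q by (intro mult_le_mono) auto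
        then show False using \<open>d \<le> m\<close> mp by simp
      qed
      then show False using q \<open>d \<noteq> 0\<close> \<open>d \<noteq> 2 * p\<close> by (cases "q = 0") (auto simp: less_2_cases_iff)
    qed
  qed (auto simp: cls_def)
  then have cls: "card (cls b j) \<le> (\<Sum>j<p. m choose j)" for b j by simp
  have "c (f A) < k" for A
    using col sphere unfolding unit_dist_colouring_def by blast
  then have "Pow {..<m} = (\<Union>(b, j)\<in>UNIV \<times> {..<k}. cls b j)"
    by (auto simp: cls_def)
  then have "2 ^ m = card (\<Union>(b, j)\<in>UNIV \<times> {..<k}. cls b j)"
    by (metis card_Pow card_lessThan finite_lessThan)
  also have "\<dots> \<le> (\<Sum>(b, j)\<in>UNIV \<times> {..<k}. card (cls b j))"
    using card_UN_le[of "UNIV \<times> {..<k}" "\<lambda>(b, j). cls b j"] by (simp add: case_prod_unfold)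
  also have "\<dots> \<le> (\<Sum>(b :: bool, j)\<in>UNIV \<times> {..<k}. \<Sum>j<p. m choose j)"
    using cls by (intro sum_mono) auto
  also have "\<dots> = 2 * k * (\<Sum>j<p. m choose j)" by (simp add: card_cartesian_product)
  finally show ?thesis .
qed

section \<open>Unfolding the extremal definitions\<close>

text \<open>The finite bound excludes the empty set, whose infimum is infinite, and an infimum of a
  nonempty set in \<open>enat\<close> is attained.\<close>

lemma colouring_of_chromatic_number_le:
  assumes "chromatic_number n S \<le> enat N"
  obtains k c where "k \<le> N" "unit_dist_colouring n S k c"
proof -
  let ?K = "{enat k | k. \<exists>c. unit_dist_colouring n S k c}"
  have "Inf ?K \<le> enat N" using assms by (simp add: chromatic_number_def)
  then have "?K \<noteq> {}" by (metis Inf_empty enat_ord_code(3) infinity_ileE top_enat_def)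
  then have "Inf ?K \<in> ?K" unfolding Inf_enat_def by (metis (mono_tags, lifting) LeastI ex_in_conv)
  then show ?thesis using assms that by (auto simp: chromatic_number_def)
qed

lemma mult4_below_bounds:
  assumes "n \<ge> 1"
  shows "mult4_below (real n) < n" "n \<le> mult4_below (real n) + 4"
proof -
  let ?K = "{k. 4 dvd k \<and> real k < real n}"
  have fin: "finite ?K" by (rule finite_subset[of _ "{..<n}"]) auto
  have "0 \<in> ?K" using assms by simp
  then have "Max ?K \<in> ?K" using fin Max_in by blast
  then show "mult4_below (real n) < n" by (simp add: mult4_below_def)
  \<comment> \<open>The multiple must lie strictly below \<open>n\<close>, hence
    \<open>n - 1\<close>; rounding down then loses at most 3.\<close>
  have "4 * ((n - 1) div 4) \<in> ?K" using assms by auto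
  then have "4 * ((n - 1) div 4) \<le> mult4_below (real n)"
    using fin unfolding mult4_below_def by (intro Max_ge)
  then show "n \<le> mult4_below (real n) + 4" by linarith
qed

lemma least_prime_above: "prime (least_prime_above x)" "x < real (least_prime_above x)"
proof -
  obtain q where "prime q" "nat \<lceil>x\<rceil> < q" using bigger_prime by blast
  then have "prime q \<and> x < real q" by linarith
  then have "prime (least_prime_above x) \<and> x < real (least_prime_above x)"
    unfolding least_prime_above_def by (rule LeastI)
  then show "prime (least_prime_above x)" "x < real (least_prime_above x)" by auto
qed

section \<open>Asymptotic comparison with \<open>n + 1\<close> colours\<close>

theorem theorem5:
  fixes r :: "nat \<Rightarrow> real" and p :: "nat \<Rightarrow> nat"
  assumes "\<And>n. n \<ge> 1 \<Longrightarrow> r n > 1 / 2"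
    and "\<And>n. n \<ge> 1 \<Longrightarrow> p n = least_prime_above (real (mult4_below (real n)) / (8 * (r n)\<^sup>2))"
    and "\<exists>\<kappa>::real. 0 < \<kappa> \<and> \<kappa> < 2 \<and>
      (\<forall>\<^sub>F n in sequentially.
        real (mult4_below (real n)) / 4 < real (p n) \<and>
        real (p n) < real (mult4_below (real n)) / 2
          - sqrt (real (mult4_below (real n)) * ln (real (mult4_below (real n))) / \<kappa>))"
  shows "\<exists>n0. \<forall>n\<ge>n0. chromatic_number n (eucl_sphere n (r n)) > enat (n + 1)"
proof -
  define m where "m n = mult4_below (real n)" for n :: nat
  obtain \<kappa> where \<kappa>: "0 < \<kappa>" "\<kappa> < 2"
    and ev: "\<forall>\<^sub>F n in sequentially. real (m n) / 4 < real (p n) \<and>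
        real (p n) < real (m n) / 2 - sqrt (real (m n) * ln (real (m n)) / \<kappa>)"
    using assms(3) unfolding m_def by blast
  \<comment> \<open>With this \<open>s\<close> the Chernoff factor becomes
    \<open>M powr - (1 + s)\<close>: one power of \<open>M\<close> absorbs the linear number of
    colours and the positive excess \<open>s\<close> gives the contradiction.\<close>
  define s where "s = 2 / \<kappa> - 1"
  have "s > 0" using \<kappa> by (simp add: s_def field_simps)
  have "filterlim (\<lambda>n. real n - 4) at_top sequentially" by real_asymp
  then have m_top: "filterlim (\<lambda>n. real (m n)) at_top sequentially"
  proof (rule filterlim_at_top_mono)
    show "\<forall>\<^sub>F n in sequentially. real n - 4 \<le> real (m n)"
      using eventually_ge_at_top[of 1]
    proof eventually_elim
      case (elim n)
      then show ?case using mult4_below_bounds(2)[of n] by (simp add: m_def)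
    qed
  qed
  have "filterlim (\<lambda>x. x powr s) at_top at_top"
    using \<open>s > 0\<close> by real_asymp
  then have "filterlim (\<lambda>n. real (m n) powr s) at_top sequentially"
    using m_top by (rule filterlim_compose)
  \<comment> \<open>The constant is generous: the final inequality would force
    \<open>12 * M < 2 * (M + 5)\<close>, impossible for \<open>M >= 8\<close>. The bound 8 also
    gives \<open>p n > M / 4 >= 2\<close>, so that the prime \<open>p n\<close> is odd.\<close>
  then have "\<forall>\<^sub>F n in sequentially. 12 < real (m n) powr s"
    by (simp add: filterlim_at_top_dense)
  moreover have "\<forall>\<^sub>F n in sequentially. 8 \<le> real (m n)"
    using m_top unfolding filterlim_at_top by blast
  ultimately have "\<forall>\<^sub>F n in sequentially. chromatic_number n (eucl_sphere n (r n)) > enat (n + 1)"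
    using ev eventually_ge_at_top[of 1]
  proof eventually_elim
    case (elim n)
    define M where "M = real (m n)"
    define t where "t = sqrt (M * ln M / \<kappa>)"
    have M: "8 \<le> M" "12 < M powr s" "M / 4 < p n" "p n < M / 2 - t"
      using elim by (auto simp: M_def t_def)
    have t: "0 \<le> t" "t\<^sup>2 = M * ln M / \<kappa>" using M \<kappa> by (auto simp: t_def)
    have prime: "prime (p n)" and above: "M / (8 * (r n)\<^sup>2) < p n"
      using least_prime_above assms(2) elim by (auto simp: M_def m_def)
    have "p n > 2" using M by linarith
    have powr: "exp ((s + 1) * ln M) = M powr s * M"
      using M powr_add[of M s 1] by (simp add: powr_def)
    show ?case
    proof (rule ccontr)
      assume "\<not> ?thesis"
      then obtain k c where k: "k \<le> n + 1" and col: "unit_dist_colouring n (eucl_sphere n (r n)) k c"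
        using colouring_of_chromatic_number_le[of n _ "n + 1"] by (metis not_le)
      have "2 ^ m n \<le> 2 * k * (\<Sum>j<p n. m n choose j)"
      proof (rule sphere_colouring_bound[OF prime _ _ _ _ _ col])
        show "odd (p n)" using prime \<open>p n > 2\<close> prime_odd_nat by blast
        show "m n < 4 * p n" using M by (simp add: M_def)
        show "m n < n" using mult4_below_bounds elim by (simp add: m_def)
        have "r n > 0" using assms(1)[of n] elim by simp
        then show "0 \<le> r n" by simp
        show "real (m n) / (8 * real (p n)) \<le> (r n)\<^sup>2"
          using above \<open>r n > 0\<close> \<open>p n > 2\<close> by (simp add: M_def field_simps)
      qed
      then have "2 ^ m n \<le> 2 * real k * real (\<Sum>j<p n. m n choose j)"
        by (metis of_nat_le_iff of_nat_mult of_nat_numeral of_nat_power)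
      also have "\<dots> \<le> 2 * (M + 5) * (2 ^ m n * exp (- 2 * t\<^sup>2 / M))"
      proof (intro mult_mono)
        \<comment> \<open>Here \<open>k <= n + 1\<close>, and \<open>n\<close> exceeds
          \<open>m n\<close> by at most 4.\<close>
        show "real k \<le> M + 5"
          using k mult4_below_bounds(2)[of n] elim by (simp add: M_def m_def)
        show "real (\<Sum>j<p n. m n choose j) \<le> 2 ^ m n * exp (- 2 * t\<^sup>2 / M)"
          unfolding M_def using M t(1) by (intro binomial_lower_tail) (auto simp: M_def)
      qed (use M in \<open>auto simp flip: of_nat_sum\<close>)
      also have "- 2 * t\<^sup>2 / M = - ((s + 1) * ln M)"
        using M \<kappa> by (simp add: t s_def)
      also have "exp \<dots> = inverse (M powr s * M)"
        by (simp only: exp_minus powr)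
      finally have "2 ^ m n * (M powr s * M) \<le> 2 ^ m n * (2 * (M + 5))"
        using M by (simp add: field_simps)
      then have "M powr s * M \<le> 2 * (M + 5)" by simp
      moreover have "12 * M < M powr s * M" using M by (intro mult_strict_right_mono) auto
      ultimately show False using M by simp
    qed
  qed
  then show ?thesis by (simp add: eventually_sequentially)
qed

end
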